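(* Let $\Bbbk$ be an algebraically closed field of characteristic zero, let $n\ge2$ and $d\ge3$, and let \[ \Omega_{n,d}=\{(c,q)\mid q_{00}\,q_{01}\,q_{10}\neq0\} \] as a subset of the parameter space of reduced pairs $(c,q)$ of degrees $(n,d)$. Then $\Omega_{n,d}$ is a nonempty Zariski open subset of this parameter space. Moreover, for every $(c,q)\in\Omega_{n,d}$, we have $\Lambda(c,q)=\mathbb Z^2$.
   Context: A reduced pair $(c,q)$ of degrees $(n,d)$ consists of $c(x)=\sum_{r=0}^{n}c_rx^r\in\Bbbk[x]$ with $c_n\neq0$, $c_{n-1}=0$, and $q(x,y)=\lambda y^d+\sum_{0\le i<n,\ 0\le j\le d-2}q_{ij}x^iy^j\in\Bbbk[x,y]$ with $\lambda\in\Bbbk^*$. The parameter space of reduced pairs is the set of all such pairs, identified with the open subset $\{c_n\neq0,\ \lambda\neq0\}$ of the affine space with coordinates $c_r$ ($0\le r\le n$, $r\ne n-1$), $\lambda$, $q_{ij}$, with the Zariski topology. $\Lambda(c,q)$ is the subgroup of $\mathbb Z^2$ generated by the vectors $(n-r,0)$ for all $r<n$ with $c_r\neq0$, together with the vectors $(i,j-d)$ for all pairs $(i,j)$ with $q_{ij}\neq0$. *)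

theory Defs
  imports
    "HOL-Library.Poly_Mapping"
    "HOL-Library.Product_Plus"
    "HOL-Computational_Algebra.Group_Closure"
    "HOL-Computational_Algebra.Polynomial"
    "HOL-Analysis.Abstract_Topology"
begin

text \<open>
  A polynomial in variables of type \<open>'v\<close> is a finitely supported map from monomials
  \<open>'v \<Rightarrow>\<^sub>0 nat\<close> to coefficients.
\<close>

definition monomial_eval :: "('v \<Rightarrow> 'a::comm_ring_1) \<Rightarrow> ('v \<Rightarrow>\<^sub>0 nat) \<Rightarrow> 'a" where
  "monomial_eval x m = (\<Prod>v\<in>Poly_Mapping.keys m. x v ^ Poly_Mapping.lookup m v)"

definition mpoly_eval :: "('v \<Rightarrow> 'a::comm_ring_1) \<Rightarrow> (('v \<Rightarrow>\<^sub>0 nat) \<Rightarrow>\<^sub>0 'a) \<Rightarrow> 'a" where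
  "mpoly_eval x p = (\<Sum>m\<in>Poly_Mapping.keys p. Poly_Mapping.lookup p m * monomial_eval x m)"

definition mpolys_in :: "'v set \<Rightarrow> (('v \<Rightarrow>\<^sub>0 nat) \<Rightarrow>\<^sub>0 'a::comm_ring_1) set" where
  "mpolys_in I = {p. \<forall>m\<in>Poly_Mapping.keys p. Poly_Mapping.keys m \<subseteq> I}"

definition affine_space :: "'v set \<Rightarrow> ('v \<Rightarrow> 'a::field) set" where
  "affine_space I = (\<Pi>\<^sub>E v\<in>I. UNIV)"

definition zero_locus :: "'v set \<Rightarrow> (('v \<Rightarrow>\<^sub>0 nat) \<Rightarrow>\<^sub>0 'a::field) set \<Rightarrow> ('v \<Rightarrow> 'a) set" where
  "zero_locus I S = {x \<in> affine_space I. \<forall>p\<in>S. mpoly_eval x p = 0}"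

definition zariski :: "'v set \<Rightarrow> ('v \<Rightarrow> 'a::field) topology" where
  "zariski I = topology (\<lambda>U. \<exists>S\<subseteq>mpolys_in I. U = affine_space I - zero_locus I S)"

text \<open>The family used in the definition of \<^const>\<open>zariski\<close> is indeed a topology.\<close>

lemma monomial_eval_superset:
  assumes "finite A" "Poly_Mapping.keys m \<subseteq> A"
  shows "monomial_eval x m = (\<Prod>v\<in>A. x v ^ Poly_Mapping.lookup m v)"
  unfolding monomial_eval_def
  by (rule prod.mono_neutral_left) (use assms in \<open>auto simp: in_keys_iff\<close>)

lemma monomial_eval_add: "monomial_eval x (m + m') = monomial_eval x m * monomial_eval x m'"
proof -
  let ?A = "Poly_Mapping.keys m \<union> Poly_Mapping.keys m'"
  have "Poly_Mapping.keys (m + m') \<subseteq> ?A"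
    by (rule Poly_Mapping.keys_add)
  then show ?thesis
    by (simp add: monomial_eval_superset[of ?A] lookup_add power_add prod.distrib)
qed

lemma mpoly_eval_superset:
  assumes "finite A" "Poly_Mapping.keys p \<subseteq> A"
  shows "mpoly_eval x p = (\<Sum>m\<in>A. Poly_Mapping.lookup p m * monomial_eval x m)"
  unfolding mpoly_eval_def
  by (rule sum.mono_neutral_left) (use assms in \<open>auto simp: in_keys_iff\<close>)

lemma mpoly_eval_zero [simp]: "mpoly_eval x 0 = 0"
  by (simp add: mpoly_eval_def)

lemma mpoly_eval_add: "mpoly_eval x (p + q) = mpoly_eval x p + mpoly_eval x q"
proof -
  let ?A = "Poly_Mapping.keys p \<union> Poly_Mapping.keys q"
  have "Poly_Mapping.keys (p + q) \<subseteq> ?A"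
    by (rule Poly_Mapping.keys_add)
  then show ?thesis
    by (simp add: mpoly_eval_superset[of ?A] lookup_add sum.distrib algebra_simps)
qed

lemma mpoly_eval_sum: "mpoly_eval x (\<Sum>i\<in>A. f i) = (\<Sum>i\<in>A. mpoly_eval x (f i))"
  by (induction A rule: infinite_finite_induct) (simp_all add: mpoly_eval_add)

lemma mpoly_eval_single: "mpoly_eval x (Poly_Mapping.single m a) = a * monomial_eval x m"
  by (simp add: mpoly_eval_superset[of "{m}"])

lemma mpoly_eq_sum_single:
  "p = (\<Sum>m\<in>Poly_Mapping.keys p. Poly_Mapping.single m (Poly_Mapping.lookup p m))"
  by (rule poly_mapping_eqI)
     (auto simp: lookup_sum lookup_single when_def in_keys_iff)

lemma mpoly_eval_mult: "mpoly_eval x (p * q) = mpoly_eval x p * mpoly_eval x q"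
proof -
  have "p * q = (\<Sum>m\<in>Poly_Mapping.keys p. \<Sum>m'\<in>Poly_Mapping.keys q.
      Poly_Mapping.single (m + m') (Poly_Mapping.lookup p m * Poly_Mapping.lookup q m'))"
    by (subst mpoly_eq_sum_single[of p], subst mpoly_eq_sum_single[of q])
       (simp add: sum_product mult_single)
  then have "mpoly_eval x (p * q) = (\<Sum>m\<in>Poly_Mapping.keys p. \<Sum>m'\<in>Poly_Mapping.keys q.
      Poly_Mapping.lookup p m * Poly_Mapping.lookup q m' * (monomial_eval x m * monomial_eval x m'))"
    by (simp only: mpoly_eval_sum mpoly_eval_single monomial_eval_add)
  also have "\<dots> = mpoly_eval x p * mpoly_eval x q"
    by (simp add: mpoly_eval_def sum_product mult_ac)
  finally show ?thesis .
qed

lemma mpolys_in_mult: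
  assumes "p \<in> mpolys_in I" "q \<in> mpolys_in I"
  shows "p * q \<in> mpolys_in I"
proof -
  have "Poly_Mapping.keys m \<subseteq> I" if m: "m \<in> Poly_Mapping.keys (p * q)" for m
  proof -
    obtain a b where "a \<in> Poly_Mapping.keys p" "b \<in> Poly_Mapping.keys q" "m = a + b"
      using subsetD[OF keys_mult m] by auto
    then show ?thesis
      using assms Poly_Mapping.keys_add[of a b] unfolding mpolys_in_def by blast
  qed
  then show ?thesis
    by (simp add: mpolys_in_def)
qed

lemma istopology_zariski:
  "istopology (\<lambda>U. \<exists>S\<subseteq>mpolys_in I. U = affine_space I - zero_locus I S)"
  unfolding istopology_def
proof (intro conjI allI impI)
  fix U V :: "('a \<Rightarrow> 'b::field) set"
  assume "\<exists>S\<subseteq>mpolys_in I. U = affine_space I - zero_locus I S"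
    and "\<exists>S\<subseteq>mpolys_in I. V = affine_space I - zero_locus I S"
  then obtain S T where S: "S \<subseteq> mpolys_in I" "U = affine_space I - zero_locus I S"
    and T: "T \<subseteq> mpolys_in I" "V = affine_space I - zero_locus I T"
    by blast
  let ?P = "{p * q | p q. p \<in> S \<and> q \<in> T}"
  have "?P \<subseteq> mpolys_in I"
    using S T mpolys_in_mult by blast
  moreover have "U \<inter> V = affine_space I - zero_locus I ?P"
    unfolding S T zero_locus_def by (auto simp: mpoly_eval_mult) (metis mpoly_eval_mult mult_eq_0_iff)
  ultimately show "\<exists>S\<subseteq>mpolys_in I. U \<inter> V = affine_space I - zero_locus I S"
    by blast
next
  fix K :: "('a \<Rightarrow> 'b::field) set set"
  assume "\<forall>U\<in>K. \<exists>S\<subseteq>mpolys_in I. U = affine_space I - zero_locus I S"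
  then obtain S where S: "\<And>U. U \<in> K \<Longrightarrow> S U \<subseteq> mpolys_in I"
      "\<And>U. U \<in> K \<Longrightarrow> U = affine_space I - zero_locus I (S U)"
    by metis
  have "\<Union>K = (\<Union>U\<in>K. affine_space I - zero_locus I (S U))"
    using S(2) by auto
  also have "\<dots> = affine_space I - zero_locus I (\<Union>U\<in>K. S U)"
    unfolding zero_locus_def by auto
  finally show "\<exists>S\<subseteq>mpolys_in I. \<Union>K = affine_space I - zero_locus I S"
    using S(1) by (intro exI[of _ "\<Union>U\<in>K. S U"]) auto
qed

lemma openin_zariski:
  "openin (zariski I) U \<longleftrightarrow> (\<exists>S\<subseteq>mpolys_in I. U = affine_space I - zero_locus I S)"
  unfolding zariski_def topology_inverse'[OF istopology_zariski] ..

lemma openin_zariski_basic: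
  assumes "p \<in> mpolys_in I"
  shows "openin (zariski I) {x \<in> affine_space I. mpoly_eval x p \<noteq> 0}"
  unfolding openin_zariski
  by (rule exI[of _ "{p}"]) (use assms in \<open>auto simp: zero_locus_def\<close>)

lemma topspace_zariski: "topspace (zariski I) = (affine_space I :: ('v \<Rightarrow> 'a::field) set)"
proof
  show "topspace (zariski I) \<subseteq> (affine_space I :: ('v \<Rightarrow> 'a) set)"
    unfolding topspace_def openin_zariski by auto
  have "openin (zariski I) {x \<in> affine_space I. mpoly_eval x (1 :: ('v \<Rightarrow>\<^sub>0 nat) \<Rightarrow>\<^sub>0 'a) \<noteq> 0}"
    by (rule openin_zariski_basic) (simp add: mpolys_in_def)
  then show "(affine_space I :: ('v \<Rightarrow> 'a) set) \<subseteq> topspace (zariski I)"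
    using openin_subset by (fastforce simp: mpoly_eval_def monomial_eval_def)
qed

text \<open>
  An element of \<open>K[x,y]\<close> is represented as an element of \<open>K[x][y]\<close>, i.e. the outer
  variable is \<open>y\<close>; \<open>bcoeff q i j\<close> is the coefficient of \<open>x\<^sup>i y\<^sup>j\<close>.
\<close>

definition bcoeff :: "'a::zero poly poly \<Rightarrow> nat \<Rightarrow> nat \<Rightarrow> 'a" where
  "bcoeff q i j = coeff (coeff q j) i"

definition bmonom :: "'a::zero \<Rightarrow> nat \<Rightarrow> nat \<Rightarrow> 'a poly poly" where
  "bmonom a i j = monom (monom a i) j"

definition reduced_pairs :: "nat \<Rightarrow> nat \<Rightarrow> ('a::field poly \<times> 'a poly poly) set" where
  "reduced_pairs n d = {(c, q).
     (\<exists>cr. c = (\<Sum>r\<le>n. monom (cr r) r) \<and> cr n \<noteq> 0 \<and> cr (n - 1) = 0) \<and>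
     (\<exists>l qc. l \<noteq> 0 \<and> q = bmonom l 0 d + (\<Sum>i<n. \<Sum>j\<le>d - 2. bmonom (qc i j) i j))}"

datatype coord = Coord_c nat | Coord_lambda | Coord_q nat nat

definition coords :: "nat \<Rightarrow> nat \<Rightarrow> coord set" where
  "coords n d = Coord_c ` ({..n} - {n - 1}) \<union> {Coord_lambda} \<union>
     {Coord_q i j | i j. i < n \<and> j \<le> d - 2}"

definition coord_map ::
    "nat \<Rightarrow> nat \<Rightarrow> 'a::field poly \<times> 'a poly poly \<Rightarrow> (coord \<Rightarrow> 'a)" where
  "coord_map n d = (\<lambda>(c, q). \<lambda>v\<in>coords n d. case v of
       Coord_c r \<Rightarrow> coeff c r
     | Coord_lambda \<Rightarrow> bcoeff q 0 d
     | Coord_q i j \<Rightarrow> bcoeff q i j)"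

definition parameter_space :: "nat \<Rightarrow> nat \<Rightarrow> ('a::field poly \<times> 'a poly poly) topology" where
  "parameter_space n d = pullback_topology (reduced_pairs n d) (coord_map n d) (zariski (coords n d))"

text \<open>
  \<^const>\<open>coord_map\<close> identifies the reduced pairs with the open subset of affine space where
  the coordinates \<open>c\<^sub>n\<close> and \<open>\<lambda>\<close> do not vanish.
\<close>

lemma coeff_sum_monom: "coeff (\<Sum>r\<le>n. monom (f r) r) k = (if k \<le> n then f k else 0)"
  by (simp add: coeff_sum)

lemma bcoeff_reduced:
  fixes q :: "'a::field poly poly"
  assumes "q = bmonom l 0 d + (\<Sum>i<n. \<Sum>j\<le>d - 2. bmonom (qc i j) i j)"
  shows "bcoeff q i j =
    (if i = 0 \<and> j = d then l else 0) + (if i < n \<and> j \<le> d - 2 then qc i j else 0)"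
proof -
  have "bcoeff q i j = (if i = 0 \<and> j = d then l else 0) +
     (\<Sum>i'<n. \<Sum>j'\<le>d - 2. if i' = i \<and> j' = j then qc i' j' else 0)"
  proof -
    have [simp]: "bcoeff (bmonom a i' j') i j = (if i' = i \<and> j' = j then a else 0)"
      for a :: 'a and i' j'
      by (simp add: bcoeff_def bmonom_def)
    have "bcoeff q i j = bcoeff (bmonom l 0 d) i j +
        (\<Sum>i'<n. \<Sum>j'\<le>d - 2. bcoeff (bmonom (qc i' j') i' j') i j)"
      unfolding assms by (simp add: bcoeff_def coeff_sum)
    then show ?thesis by auto
  qed
  also have "(\<Sum>i'<n. \<Sum>j'\<le>d - 2. if i' = i \<and> j' = j then qc i' j' else 0) =
     (\<Sum>i'<n. if i' = i then (\<Sum>j'\<le>d - 2. if j' = j then qc i j' else 0) else 0)"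
    by (rule sum.cong[OF refl]) simp
  also have "\<dots> = (if i < n \<and> j \<le> d - 2 then qc i j else 0)"
    by simp
  finally show ?thesis .
qed

lemma bij_betw_coord_map:
  assumes "1 \<le> n" "2 \<le> d"
  shows "bij_betw (coord_map n d) (reduced_pairs n d)
    {x \<in> affine_space (coords n d). x (Coord_c n) \<noteq> (0::'a::field) \<and> x Coord_lambda \<noteq> 0}"
    (is "bij_betw ?f ?R ?X")
proof (rule bij_betwI')
  fix p p' :: "'a poly \<times> 'a poly poly" assume p: "p \<in> ?R" "p' \<in> ?R"
  obtain c q c' q' where pq: "p = (c, q)" "p' = (c', q')" by fastforce
  obtain cr l qc where c: "c = (\<Sum>r\<le>n. monom (cr r) r)" "cr n \<noteq> 0" "cr (n - 1) = 0"
    and q: "l \<noteq> 0" "q = bmonom l 0 d + (\<Sum>i<n. \<Sum>j\<le>d - 2. bmonom (qc i j) i j)"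
    using p(1) unfolding pq reduced_pairs_def by blast
  obtain cr' l' qc' where c': "c' = (\<Sum>r\<le>n. monom (cr' r) r)" "cr' n \<noteq> 0" "cr' (n - 1) = 0"
    and q': "l' \<noteq> 0" "q' = bmonom l' 0 d + (\<Sum>i<n. \<Sum>j\<le>d - 2. bmonom (qc' i j) i j)"
    using p(2) unfolding pq reduced_pairs_def by blast
  show "?f p = ?f p' \<longleftrightarrow> p = p'"
  proof
    assume eq: "?f p = ?f p'"
    have "coeff c r = coeff c' r" for r
    proof (cases "r \<le> n \<and> r \<noteq> n - 1")
      case True
      then show ?thesis
        using fun_cong[OF eq, of "Coord_c r"] by (auto simp: coord_map_def pq coords_def)
    next
      case False
      then show ?thesis
        using c c' by (auto simp: coeff_sum_monom)
    qed
    then have "c = c'" by (simp add: poly_eq_iff)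
    have "bcoeff q i j = bcoeff q' i j" for i j
    proof -
      consider "i = 0 \<and> j = d" | "i < n \<and> j \<le> d - 2" | "\<not> (i = 0 \<and> j = d)" "\<not> (i < n \<and> j \<le> d - 2)"
        by blast
      then show ?thesis
      proof cases
        case 1
        then show ?thesis
          using fun_cong[OF eq, of Coord_lambda] by (auto simp: coord_map_def pq coords_def)
      next
        case 2
        then show ?thesis
          using fun_cong[OF eq, of "Coord_q i j"] by (auto simp: coord_map_def pq coords_def)
      next
        case 3
        then show ?thesis
          unfolding bcoeff_reduced[OF q(2)] bcoeff_reduced[OF q'(2)] by auto
      qed
    qed
    then have "q = q'" by (simp add: poly_eq_iff bcoeff_def)
    with \<open>c = c'\<close> show "p = p'" by (simp add: pq)
  qed simp
next
  fix p :: "'a poly \<times> 'a poly poly" assume p: "p \<in> ?R"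
  obtain c q where pq: "p = (c, q)" by fastforce
  obtain cr l qc where c: "c = (\<Sum>r\<le>n. monom (cr r) r)" "cr n \<noteq> 0" "cr (n - 1) = 0"
    and q: "l \<noteq> 0" "q = bmonom l 0 d + (\<Sum>i<n. \<Sum>j\<le>d - 2. bmonom (qc i j) i j)"
    using p unfolding pq reduced_pairs_def by blast
  have "\<not> d \<le> d - 2" "n \<noteq> n - 1" using assms by auto
  then show "?f p \<in> ?X"
    using c(2) q(1) bcoeff_reduced[OF q(2), of 0 d]
    by (auto simp: pq coord_map_def affine_space_def coords_def coeff_sum_monom c(1))
next
  fix x :: "coord \<Rightarrow> 'a" assume x: "x \<in> ?X"
  define c where "c = (\<Sum>r\<le>n. monom (if r = n - 1 then 0 else x (Coord_c r)) r)"
  define q where "q = bmonom (x Coord_lambda) 0 d +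
    (\<Sum>i<n. \<Sum>j\<le>d - 2. bmonom (x (Coord_q i j)) i j)"
  have ne: "\<not> d \<le> d - 2" "n \<noteq> n - 1" using assms by auto
  have R: "(c, q) \<in> ?R"
    unfolding reduced_pairs_def using x ne
    by (auto simp: q_def c_def
        intro!: exI[of _ "\<lambda>r. if r = n - 1 then 0 else x (Coord_c r)"] exI[of _ "x Coord_lambda"]
          exI[of _ "\<lambda>i j. x (Coord_q i j)"])
  have "x v = ?f (c, q) v" for v
  proof (cases "v \<in> coords n d")
    case True
    then show ?thesis
      using ne by (auto simp: coord_map_def coords_def bcoeff_reduced[OF q_def] c_def
          coeff_sum_monom split: if_splits)
  next
    case False
    then show ?thesis
      using x by (auto simp: coord_map_def affine_space_def)
  qed
  with R show "\<exists>p\<in>?R. x = ?f p" by blast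
qed

lemma topspace_parameter_space: "topspace (parameter_space n d) = reduced_pairs n d"
  unfolding parameter_space_def topspace_pullback_topology topspace_zariski
  by (auto simp: affine_space_def coord_map_def)

definition Omega :: "nat \<Rightarrow> nat \<Rightarrow> ('a::field poly \<times> 'a poly poly) set" where
  "Omega n d = {(c, q). (c, q) \<in> reduced_pairs n d \<and>
     bcoeff q 0 0 * bcoeff q 0 1 * bcoeff q 1 0 \<noteq> 0}"

definition Lambda :: "nat \<Rightarrow> nat \<Rightarrow> 'a::field poly \<Rightarrow> 'a poly poly \<Rightarrow> (int \<times> int) set" where
  "Lambda n d c q = group_closure
     ({(int n - int r, 0) | r. r < n \<and> coeff c r \<noteq> 0} \<union>
      {(int i, int j - int d) | i j. i < n \<and> j \<le> d - 2 \<and> bcoeff q i j \<noteq> 0})"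

end

theory Submission
  imports Defs
begin

text \<open>
  The locus \<open>q\<^sub>0\<^sub>0 q\<^sub>0\<^sub>1 q\<^sub>1\<^sub>0 \<noteq> 0\<close> is the nonvanishing locus of a single monomial in the coordinates
  of the parameter space, hence a basic Zariski open set (\<open>openin_zariski_coordinates_nonzero\<close>); the hypotheses \<open>n \<ge> 2\<close> and \<open>d \<ge> 3\<close>
  guarantee that \<open>q\<^sub>0\<^sub>0\<close>, \<open>q\<^sub>0\<^sub>1\<close> and \<open>q\<^sub>1\<^sub>0\<close> really are coordinates. The locus contains the pair
  given by \<open>c = x\<^sup>n\<close> and \<open>q\<close> with all admissible coefficients equal to 1. Finally, the three
  nonvanishing coefficients contribute the vectors \<open>(0, -d)\<close>, \<open>(0, 1 - d)\<close> and \<open>(1, -d)\<close> to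
  \<open>\<Lambda>\<close>, and subtracting the first from the other two yields the standard basis of \<open>\<int>\<^sup>2\<close>
  (\<open>Lambda_eq_UNIV\<close>).
\<close>

lemma openin_zariski_coordinates_nonzero:
  fixes u v w :: 'v
  assumes "{u, v, w} \<subseteq> I"
  shows "openin (zariski I) {x \<in> affine_space I. x u * x v * x w \<noteq> (0::'a::field)}"
proof -
  define m :: "'v \<Rightarrow>\<^sub>0 nat"
    where "m = Poly_Mapping.single u 1 + Poly_Mapping.single v 1 + Poly_Mapping.single w 1"
  have "Poly_Mapping.keys m \<subseteq> {u, v, w}"
    by (auto simp: m_def in_keys_iff lookup_add lookup_single when_def split: if_splits)
  then have "Poly_Mapping.single m (1::'a) \<in> mpolys_in I"
    using assms by (auto simp: mpolys_in_def)
  moreover have "mpoly_eval x (Poly_Mapping.single m 1) = x u * x v * x w" for x :: "'v \<Rightarrow> 'a"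
  proof -
    have "monomial_eval x (Poly_Mapping.single t 1) = x t" for t
      by (simp add: monomial_eval_def)
    then show ?thesis
      by (simp only: mpoly_eval_single m_def monomial_eval_add mult_1_left)
  qed
  ultimately show ?thesis
    using openin_zariski_basic[of "Poly_Mapping.single m (1::'a)" I] by simp
qed

lemma openin_Omega:
  assumes "n \<ge> 2" and "d \<ge> 3"
  shows "openin (parameter_space n d) (Omega n d :: ('a::field poly \<times> 'a poly poly) set)"
proof -
  let ?U = "{x \<in> affine_space (coords n d).
    x (Coord_q 0 0) * x (Coord_q 0 1) * x (Coord_q 1 0) \<noteq> (0::'a)}"
  have q_coords: "{Coord_q 0 0, Coord_q 0 1, Coord_q 1 0} \<subseteq> coords n d"
    using assms by (auto simp: coords_def)
  have "(c, q) \<in> Omega n d \<longleftrightarrow> (c, q) \<in> coord_map n d -` ?U \<inter> reduced_pairs n d"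
    for c :: "'a poly" and q
    using q_coords by (auto simp: Omega_def coord_map_def affine_space_def)
  then have "Omega n d = coord_map n d -` ?U \<inter> reduced_pairs n d"
    by (auto simp only: set_eq_iff split_paired_all)
  moreover have "openin (zariski (coords n d)) ?U"
    by (rule openin_zariski_coordinates_nonzero[OF q_coords])
  ultimately show ?thesis
    unfolding parameter_space_def openin_pullback_topology by blast
qed

lemma Omega_nonempty:
  assumes "n \<ge> 2" and "d \<ge> 3"
  shows "(Omega n d :: ('a::field poly \<times> 'a poly poly) set) \<noteq> {}"
proof -
  define e where "e r = (if r = n then 1 else (0::'a))" for r
  define q where "q = bmonom (1::'a) 0 d + (\<Sum>i<n. \<Sum>j\<le>d - 2. bmonom 1 i j)"
  have "((\<Sum>r\<le>n. monom (e r) r), q) \<in> reduced_pairs n d"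
    unfolding reduced_pairs_def q_def using assms
    by (auto simp: e_def intro!: exI[of _ e] exI[of _ "1::'a"] exI[of _ "\<lambda>_ _. 1::'a"])
  moreover have "bcoeff q 0 0 * bcoeff q 0 1 * bcoeff q 1 0 \<noteq> 0"
    using assms by (simp add: bcoeff_reduced[OF q_def])
  ultimately show ?thesis
    by (auto simp: Omega_def)
qed

lemma group_closure_nat_multiple:
  assumes "v \<in> group_closure S"
  shows "(\<Sum>_<k::nat. v) \<in> group_closure (S :: 'b::ab_group_add set)"
  by (induction k) (auto simp: assms group_closure_add add.commute)

text \<open>
  Adding basis vectors repeatedly reaches the nonnegative quadrant, and every vector of \<open>\<int>\<^sup>2\<close> is
  the difference of its positive and its negative part.
\<close>

lemma group_closure_eq_UNIV_if_basis:
  fixes S :: "(int \<times> int) set"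
  assumes "(1, 0) \<in> group_closure S" and "(0, 1) \<in> group_closure S"
  shows "group_closure S = UNIV"
proof -
  have quadrant: "(int a, int b) \<in> group_closure S" for a b
  proof -
    have "(\<Sum>_<a. (1, 0)) + (\<Sum>_<b. (0, 1)) \<in> group_closure S"
      by (intro group_closure_add group_closure_nat_multiple assms)
    moreover have "(\<Sum>_<a. (1, 0)) = (int a, 0::int)" "(\<Sum>_<b. (0, 1)) = (0::int, int b)"
      by (simp_all add: prod_eq_iff fst_sum snd_sum)
    ultimately show ?thesis by simp
  qed
  have "(a, b) \<in> group_closure S" for a b
    using group_closure.diff[OF quadrant[of "nat a" "nat b"] quadrant[of "nat (- a)" "nat (- b)"]]
    by (simp split: if_splits)
  then show ?thesis by auto
qed

lemma Lambda_eq_UNIV: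
  assumes "n \<ge> 2" and "d \<ge> 3"
    and "bcoeff q 0 0 \<noteq> 0" "bcoeff q 0 1 \<noteq> 0" "bcoeff q 1 0 \<noteq> 0"
  shows "Lambda n d c q = UNIV"
proof -
  have gen: "(int i, int j - int d) \<in> Lambda n d c q"
    if "i < n" "j \<le> d - 2" "bcoeff q i j \<noteq> 0" for i j
    unfolding Lambda_def using that by (intro group_closure.base) auto
  have "(0, - int d) \<in> Lambda n d c q" "(0, 1 - int d) \<in> Lambda n d c q"
    "(1, - int d) \<in> Lambda n d c q"
    using gen[of 0 0] gen[of 0 1] gen[of 1 0] assms by auto
  then have "(1, - int d) - (0, - int d) \<in> Lambda n d c q"
    "(0, 1 - int d) - (0, - int d) \<in> Lambda n d c q"
    unfolding Lambda_def by (blast intro: group_closure.diff)+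
  then show ?thesis
    unfolding Lambda_def by (intro group_closure_eq_UNIV_if_basis) simp_all
qed

theorem proposition13:
  fixes n d :: nat
  assumes "n \<ge> 2" and "d \<ge> 3"
  shows "(Omega n d :: ('a::{alg_closed_field, field_char_0} poly \<times> 'a poly poly) set) \<noteq> {} \<and>
         openin (parameter_space n d) (Omega n d :: ('a poly \<times> 'a poly poly) set) \<and>
         (\<forall>(c, q) \<in> (Omega n d :: ('a poly \<times> 'a poly poly) set). Lambda n d c q = UNIV)"
  using Omega_nonempty[OF assms] openin_Omega[OF assms] Lambda_eq_UNIV[OF assms]
  by (auto simp: Omega_def)

end
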